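(* Fix a real number $\alpha \ge 0$ and an integer $s \ge 1$. For every integer $x \ge 1$, $$S_{4,s,x}^{(\alpha)} = \sum_{p=0}^s\sum_{m=0}^s\sum_{u=0}^s \sum_{k=1}^x \left( C_{42,s}(x, k; p, m, u) - C_{43,s}(x, k; p, m+1, u)\right) \sigma_{m+\alpha-u,p+1}(k) - \sum_{p=0}^s\sum_{u=0}^s \sum_{k=1}^x C_{43,s}(x, k; p, 0, u)\, \sigma_{\alpha-1-u,p+1}(k)$$ and $$S_{8,s,x}^{(\alpha)} = \sum_{p=0}^s\sum_{u=0}^s\sum_{w=0}^s \sum_{k=1}^{x+1} \left(C_{82,s}(x, k; w, p, u) - C_{83,s}(x, k; w, p, u) \right) \sigma_{w+\alpha-1-u,p+2}(k).$$
   Context: Notation: $\left[{a \atop b}\right]$ denotes the unsigned Stirling number of the first kind and $\left\{{a \atop b}\right\}$ the Stirling number of the second kind; both are $0$ unless $0 \le b \le a$ (and equal $1$ for $a=b=0$). For an integer $a$ and integer $b \ge 0$, $\binom{a}{b} = a(a-1)\cdots(a-b+1)/b!$, and $\binom{a}{b}=0$ for $b<0$. The convention $0^0=1$ is used, and any summand containing a factor $\binom{j}{u}$ with $u>j$ is taken to be $0$. $[q^x]F$ is the coefficient of $q^x$ in a formal power series $F$ in $q$. For real $\beta$ and integers $m, n \ge 1$, the bounded-divisor sum is $\sigma_{\beta,m}(n) := \sum_{d \mid n,\ d \le \lfloor n/m \rfloor} d^{\beta}$ (sum over positive divisors $d$ of $n$ with $d \le \lfloor n/m\rfloor$). For integers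 $0 \le r \le s$ and $p, m \ge 0$: $$C_{4,s}(r,p,m) := \sum_{k=0}^m \binom{s}{r} \left[{s-r \atop m}\right] \left\{{m \atop k}\right\} \binom{s-r-k}{p} (-1)^{s-r-k+p} k!\, r!.$$ For integers $0 \le r \le s$, $0 \le n \le r+1$, $p, w \ge 0$: $$C_{8,s}(r,p,n,w) := \sum_{m=0}^{s-r} \sum_{k=0}^m \sum_{m_1=0}^{r+1-n} \sum_{m_2=0}^n \binom{s}{r} \left[{s-r \atop m}\right] \left\{{m \atop k}\right\} \binom{s-r-k}{p} \left[{r+1-n \atop m_1}\right] \left[{n \atop m_2}\right] \binom{m_2}{w-m-m_1} (-1)^{s-k+p+n+m_1+m_2} k!\, (n-2-r)^{m+m_1+m_2-w}.$$ For integers $x, k$ and $p, m, u, w \ge 0$: $$C_{42,s}(x,k;p,m,u) := \sum_{r=0}^s \sum_{j=0}^{s-r} \binom{x-k}{r} \left[{s-r \atop j}\right] \binom{j}{u} \frac{(-1)^{s-r-u} (p+1-s+r)^{j-u} k^u}{(s-r)!} C_{4,s}(r,p,m),$$ $$C_{43,s}(x,k;p,m,u) := \sum_{r=0}^s \sum_{j=0}^{s-r} \binom{x+1-k}{r+1} \left[{s-r \atop j}\right] \binom{j}{u} \frac{(-1)^{s-r-u} (r+1) (p+1-s+r)^{j-u} k^u}{(s-r)!} C_{4,s}(r,p,m),$$ $$C_{82,s}(x,k;w,p,u) := \sum_{r=0}^s \sum_{n=0}^{r+1} \sum_{j=0}^{s-r} \binom{x+1-n-k+r}{r} \binom{r}{n}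 \left[{s-r \atop j}\right] \binom{j}{u} \frac{(-1)^{s-r-u} (p+2-s+r)^{j-u} k^u}{(s-r)!} C_{8,s}(r,p,n,w),$$ $$C_{83,s}(x,k;w,p,u) := \sum_{r=0}^s \sum_{n=0}^{r+1} \sum_{j=0}^{s-r} \binom{x+2-n-k+r}{r+1} \binom{r+1}{n} \left[{s-r \atop j}\right] \binom{j}{u} \frac{(-1)^{s-r-u} (p+2-s+r)^{j-u} k^u}{(s-r)!} C_{8,s}(r,p,n,w).$$ For each integer $i \ge 1$, define the formal power series in $q$ $$\mathrm{Sum}_{4,s}(q,i) := \sum_{r=0}^s\sum_{p=0}^s\sum_{m=0}^s \frac{q^{(p+1)i+r}}{(1-q^i)^{s-r+1}} \left( \frac{i^{m+1}}{(1-q)^{r+1}} - \frac{(r+1) i^m}{(1-q)^{r+2}} \right) C_{4,s}(r,p,m),$$ $$\mathrm{Sum}_{8,s}(q,i) := \sum_{r=0}^s\sum_{p=0}^s \sum_{n=0}^{r+1} \sum_{w=0}^s \frac{q^{(p+2)i+n-1}}{(1-q^i)^{s-r+1}} \left( \binom{r}{n} \frac{1}{(1-q)^{r+1}} - \binom{r+1}{n} \frac{1}{(1-q)^{r+2}} \right) i^w C_{8,s}(r,p,n,w),$$ and set $S_{4,s,x}^{(\alpha)} := [q^x] \sum_{i \ge 1} \mathrm{Sum}_{4,s}(q,i)\, i^{\alpha-1}$ and $S_{8,s,x}^{(\alpha)} := [q^x] \sum_{i \ge 1} \mathrm{Sum}_{8,s}(q,i)\, i^{\alpha-1}$. *)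

theory Defs
  imports
    Complex_Main
    "HOL-Computational_Algebra.Formal_Power_Series"
    "HOL-Combinatorics.Stirling"
begin

text \<open>
  Library notation: \<open>stirling\<close> is the unsigned first kind, \<open>Stirling\<close> the second kind.

  Differences such as \<open>s - r\<close> are taken in \<open>nat\<close> only where the summation ranges make them
  nonnegative. Every other exponent or binomial argument is formed in \<open>int\<close>, with \<open>powi\<close> as the
  power (\<open>0 powi 0 = 1\<close>). Summands in which such an exponent is negative vanish because of a
  Stirling or binomial factor, which also realises the convention on \<open>j choose u\<close> for \<open>u > j\<close>.
\<close>

definition zbinom :: "int \<Rightarrow> int \<Rightarrow> real" where
  "zbinom a b = (if b < 0 then 0 else of_int a gchoose nat b)"

definition bdd_divisor_sum :: "real \<Rightarrow> nat \<Rightarrow> nat \<Rightarrow> real" where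
  "bdd_divisor_sum \<beta> m n = (\<Sum>d | d dvd n \<and> d \<le> n div m. real d powr \<beta>)"

definition C4 :: "nat \<Rightarrow> nat \<Rightarrow> nat \<Rightarrow> nat \<Rightarrow> real" where
  "C4 s r p m =
    (\<Sum>k=0..m. real (s choose r) * real (stirling (s - r) m) * real (Stirling m k)
       * zbinom (int s - int r - int k) (int p)
       * (-1) powi (int s - int r - int k + int p) * fact k * fact r)"

definition C8 :: "nat \<Rightarrow> nat \<Rightarrow> nat \<Rightarrow> nat \<Rightarrow> nat \<Rightarrow> real" where
  "C8 s r p n w =
    (\<Sum>m=0..s-r. \<Sum>k=0..m. \<Sum>m1=0..r+1-n. \<Sum>m2=0..n.
       real (s choose r) * real (stirling (s - r) m) * real (Stirling m k)
       * zbinom (int s - int r - int k) (int p)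
       * real (stirling (r + 1 - n) m1) * real (stirling n m2)
       * zbinom (int m2) (int w - int m - int m1)
       * (-1) powi (int s - int k + int p + int n + int m1 + int m2) * fact k
       * of_int (int n - 2 - int r) powi (int m + int m1 + int m2 - int w))"

definition C42 :: "nat \<Rightarrow> int \<Rightarrow> int \<Rightarrow> nat \<Rightarrow> nat \<Rightarrow> nat \<Rightarrow> real" where
  "C42 s x k p m u =
    (\<Sum>r=0..s. \<Sum>j=0..s-r.
       zbinom (x - k) (int r) * real (stirling (s - r) j) * real (j choose u)
       * ((-1) powi (int s - int r - int u)
          * of_int (int p + 1 - int s + int r) powi (int j - int u) * of_int k ^ u
          / fact (s - r))
       * C4 s r p m)"

definition C43 :: "nat \<Rightarrow> int \<Rightarrow> int \<Rightarrow> nat \<Rightarrow> nat \<Rightarrow> nat \<Rightarrow> real" where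
  "C43 s x k p m u =
    (\<Sum>r=0..s. \<Sum>j=0..s-r.
       zbinom (x + 1 - k) (int r + 1) * real (stirling (s - r) j) * real (j choose u)
       * ((-1) powi (int s - int r - int u) * real (r + 1)
          * of_int (int p + 1 - int s + int r) powi (int j - int u) * of_int k ^ u
          / fact (s - r))
       * C4 s r p m)"

definition C82 :: "nat \<Rightarrow> int \<Rightarrow> int \<Rightarrow> nat \<Rightarrow> nat \<Rightarrow> nat \<Rightarrow> real" where
  "C82 s x k w p u =
    (\<Sum>r=0..s. \<Sum>n=0..r+1. \<Sum>j=0..s-r.
       zbinom (x + 1 - int n - k + int r) (int r) * real (r choose n)
       * real (stirling (s - r) j) * real (j choose u)
       * ((-1) powi (int s - int r - int u)
          * of_int (int p + 2 - int s + int r) powi (int j - int u) * of_int k ^ u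
          / fact (s - r))
       * C8 s r p n w)"

definition C83 :: "nat \<Rightarrow> int \<Rightarrow> int \<Rightarrow> nat \<Rightarrow> nat \<Rightarrow> nat \<Rightarrow> real" where
  "C83 s x k w p u =
    (\<Sum>r=0..s. \<Sum>n=0..r+1. \<Sum>j=0..s-r.
       zbinom (x + 2 - int n - k + int r) (int r + 1) * real ((r + 1) choose n)
       * real (stirling (s - r) j) * real (j choose u)
       * ((-1) powi (int s - int r - int u)
          * of_int (int p + 2 - int s + int r) powi (int j - int u) * of_int k ^ u
          / fact (s - r))
       * C8 s r p n w)"

definition Sum4 :: "nat \<Rightarrow> nat \<Rightarrow> real fps" where
  "Sum4 s i =
    (\<Sum>r=0..s. \<Sum>p=0..s. \<Sum>m=0..s.
       fps_X ^ ((p + 1) * i + r) / (1 - fps_X ^ i) ^ (s - r + 1)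
       * (fps_const (real i ^ (m + 1)) / (1 - fps_X) ^ (r + 1)
          - fps_const (real (r + 1) * real i ^ m) / (1 - fps_X) ^ (r + 2))
       * fps_const (C4 s r p m))"

text \<open>For \<open>i \<ge> 1\<close> the exponent \<open>(p + 2) * i + n - 1\<close> involves no truncation.\<close>

definition Sum8 :: "nat \<Rightarrow> nat \<Rightarrow> real fps" where
  "Sum8 s i =
    (\<Sum>r=0..s. \<Sum>p=0..s. \<Sum>n=0..r+1. \<Sum>w=0..s.
       fps_X ^ ((p + 2) * i + n - 1) / (1 - fps_X ^ i) ^ (s - r + 1)
       * (fps_const (real (r choose n)) * (1 / (1 - fps_X) ^ (r + 1))
          - fps_const (real ((r + 1) choose n)) * (1 / (1 - fps_X) ^ (r + 2)))
       * fps_const (real i ^ w) * fps_const (C8 s r p n w))"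

text \<open>
  The sums over \<open>i \<ge> 1\<close> are infinite sums in the topology of formal power series, indexed by
  \<open>Suc i\<close>; \<open>summable_Sum4\<close> and \<open>summable_Sum8\<close> below show that they converge.
\<close>

definition S4 :: "nat \<Rightarrow> nat \<Rightarrow> real \<Rightarrow> real" where
  "S4 s x \<alpha> = fps_nth (\<Sum>i. Sum4 s (Suc i) * fps_const (real (Suc i) powr (\<alpha> - 1))) x"

definition S8 :: "nat \<Rightarrow> nat \<Rightarrow> real \<Rightarrow> real" where
  "S8 s x \<alpha> = fps_nth (\<Sum>i. Sum8 s (Suc i) * fps_const (real (Suc i) powr (\<alpha> - 1))) x"

lemma fps_summableI:
  fixes f :: "nat \<Rightarrow> real fps"
  assumes "\<And>i n. n < i \<Longrightarrow> fps_nth (f i) n = 0"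
  shows "summable f"
proof -
  let ?S = "Abs_fps (\<lambda>n. \<Sum>i\<le>n. fps_nth (f i) n)"
  have "(\<lambda>N. \<Sum>i<N. f i) \<longlonglongrightarrow> ?S"
  proof (rule tendsto_fpsI)
    fix n
    have "fps_nth (\<Sum>i<N. f i) n = fps_nth ?S n" if "N > n" for N
    proof -
      have "(\<Sum>i<N. fps_nth (f i) n) = (\<Sum>i\<le>n. fps_nth (f i) n)"
        using that assms by (intro sum.mono_neutral_right) auto
      then show ?thesis by (simp add: fps_sum_nth)
    qed
    then show "\<forall>\<^sub>F N in sequentially. fps_nth (\<Sum>i<N. f i) n = fps_nth ?S n"
      by (intro eventually_mono[OF eventually_gt_at_top[of n]])
  qed
  then show ?thesis by (auto simp: summable_def sums_def)
qed

lemma fps_nth_X_power_quotient_eq_0: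
  fixes A B :: "real fps"
  assumes "n < e" and "fps_nth A 0 \<noteq> 0"
  shows "fps_nth (fps_X ^ e / A * B) n = 0"
proof -
  have "fps_X ^ e / A * B = fps_X ^ e * (inverse A * B)"
    by (simp only: fps_divide_unit[OF assms(2)] mult.assoc)
  then show ?thesis using assms(1) by (simp only: fps_X_power_mult_nth if_True)
qed

lemma fps_nth_one_minus_X_power_0:
  assumes "i > 0"
  shows "fps_nth ((1 - fps_X ^ i :: real fps) ^ e) 0 \<noteq> 0"
  using assms by (simp add: fps_nth_power_0 fps_X_power_iff)

lemma summable_Sum4:
  "summable (\<lambda>i. Sum4 s (Suc i) * fps_const (real (Suc i) powr (\<alpha> - 1)))"
proof (rule fps_summableI)
  fix i n :: nat
  assume "n < i"
  then have lt: "n < (p + 1) * Suc i + r" for p r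
    by (simp add: algebra_simps)
  show "fps_nth (Sum4 s (Suc i) * fps_const (real (Suc i) powr (\<alpha> - 1))) n = 0"
    unfolding Sum4_def sum_distrib_right fps_sum_nth
    by (intro sum.neutral ballI, unfold mult.assoc)
       (rule fps_nth_X_power_quotient_eq_0[OF lt fps_nth_one_minus_X_power_0, unfolded mult.assoc], simp)
qed

lemma summable_Sum8:
  "summable (\<lambda>i. Sum8 s (Suc i) * fps_const (real (Suc i) powr (\<alpha> - 1)))"
proof (rule fps_summableI)
  fix i n :: nat
  assume "n < i"
  then have lt: "n < (p + 2) * Suc i + r - 1" for p r
    by (simp add: algebra_simps)
  show "fps_nth (Sum8 s (Suc i) * fps_const (real (Suc i) powr (\<alpha> - 1))) n = 0"
    unfolding Sum8_def sum_distrib_right fps_sum_nth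
    by (intro sum.neutral ballI, unfold mult.assoc)
       (rule fps_nth_X_power_quotient_eq_0[OF lt fps_nth_one_minus_X_power_0, unfolded mult.assoc], simp)
qed

end

theory Submission
  imports Defs
begin

text \<open>
  Expanding both geometric-type factors of
  \<open>q^(P i + e) / ((1 - q^i)^(N + 1) (1 - q)^(M + 1))\<close> and collecting the terms in which the first
  factor contributes \<open>q^k\<close> gives \<open>((k/i - P + N) choose N) * ((y - k - e + M) choose M)\<close>, where \<open>i\<close>
  runs over the divisors of \<open>k\<close> with \<open>k/i \<ge> P\<close>, that is \<open>i \<le> \<lfloor>k/P\<rfloor>\<close>. The first binomial is a polynomial
  in \<open>k/i\<close>, whose coefficients come from the Stirling expansion of the falling factorial, so after
  weighting by \<open>i^\<beta>\<close> the sum over \<open>i\<close> turns each monomial \<open>(k/i)^u\<close> into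
  \<open>k^u\<close> times a bounded-divisor sum with exponent \<open>\<beta> - u\<close>. Both identities follow by linearity;
  the numbers \<open>C4\<close> and \<open>C8\<close> enter only as constants.
\<close>

section \<open>Coefficients of the building-block series\<close>

text \<open>Induction on \<open>N\<close>: Pascal's rule gives
  \<open>A (Suc N) * (1 - fps_X ^ i) = A N\<close>, so multiplying \<open>A N\<close> by
  \<open>Suc N\<close> such factors leads down to 1.\<close>

lemma fps_nth_inverse_one_minus_X_power:
  assumes "i > 0"
  shows "fps_nth (inverse ((1 - fps_X ^ i :: real fps) ^ Suc N)) n =
    (if i dvd n then real ((n div i + N) choose N) else 0)"
proof -
  define A where "A N = Abs_fps (\<lambda>n. if i dvd n then real ((n div i + N) choose N) else 0)" for N
  have split: "fps_nth (A N * (1 - fps_X ^ i)) n =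
      fps_nth (A N) n - (if n < i then 0 else fps_nth (A N) (n - i))" for N n
  proof -
    have "A N * (1 - fps_X ^ i) = A N - fps_X ^ i * A N" by (simp add: algebra_simps)
    then show ?thesis by (simp add: fps_X_power_mult_nth)
  qed
  have base: "A 0 * (1 - fps_X ^ i) = 1"
  proof (rule fps_ext)
    fix n
    show "fps_nth (A 0 * (1 - fps_X ^ i)) n = fps_nth 1 n"
      unfolding split using assms by (auto simp: A_def dvd_minus_self nat_dvd_not_less)
  qed
  have step: "A (Suc N) * (1 - fps_X ^ i) = A N" for N
  proof (rule fps_ext)
    fix n
    show "fps_nth (A (Suc N) * (1 - fps_X ^ i)) n = fps_nth (A N) n"
    proof (cases "i dvd n")
      case True
      then obtain t where "n = i * t" ..
      then show ?thesis
        unfolding split using assms by (cases t) (auto simp: A_def algebra_simps)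
    next
      case False
      then show ?thesis
        unfolding split using assms by (auto simp: A_def dvd_minus_self)
    qed
  qed
  have "A N * (1 - fps_X ^ i) ^ Suc N = 1"
  proof (induction N)
    case 0
    then show ?case using base by simp
  next
    case (Suc N)
    have "A (Suc N) * (1 - fps_X ^ i) ^ Suc (Suc N) =
        (A (Suc N) * (1 - fps_X ^ i)) * (1 - fps_X ^ i) ^ Suc N"
      by (simp only: power_Suc mult.assoc)
    also have "\<dots> = 1" by (simp only: step Suc.IH)
    finally show ?case .
  qed
  then have "inverse ((1 - fps_X ^ i) ^ Suc N) = A N"
    by (metis fps_inverse_unique mult.commute)
  then show ?thesis by (simp add: A_def)
qed

text \<open>\<open>Sum4\<close>, and \<open>Sum8\<close> after a factor q, are combinations of these
  series with \<open>N = s - r\<close> and \<open>M\<close> equal to \<open>r\<close> or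
  \<open>r + 1\<close>. The \<open>Suc\<close> in the exponents makes \<open>N\<close> and
  \<open>M\<close> the lower indices of the resulting binomials.\<close>

definition kernel :: "nat \<Rightarrow> nat \<Rightarrow> nat \<Rightarrow> nat \<Rightarrow> nat \<Rightarrow> real fps" where
  "kernel P e N M i =
    fps_X ^ (P * i + e) * inverse ((1 - fps_X ^ i) ^ Suc N) * inverse ((1 - fps_X) ^ Suc M)"

text \<open>The hypothesis \<open>e \<le> M\<close> makes the last binomial coefficient vanish for \<open>y - e < k \<le> y\<close>.\<close>

lemma fps_nth_kernel:
  assumes "i > 0" and "P > 0" and "e \<le> M"
  shows "fps_nth (kernel P e N M i) y =
    (\<Sum>k=1..y. if i dvd k \<and> i \<le> k div P
       then real ((k div i - P + N) choose N) * real ((y + M - e - k) choose M) else 0)"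
proof -
  let ?A = "fps_X ^ (P * i) * inverse ((1 - fps_X ^ i :: real fps) ^ Suc N)"
  let ?B = "fps_X ^ e * inverse ((1 - fps_X :: real fps) ^ Suc M)"
  have A: "fps_nth ?A k =
      (if i dvd k \<and> i \<le> k div P then real ((k div i - P + N) choose N) else 0)" for k
  proof -
    \<comment> \<open>The support condition \<open>P * i \<le> k\<close> of the first factor is the
      source of the bound on divisors in \<open>bdd_divisor_sum\<close>.\<close>
    have "i \<le> k div P \<longleftrightarrow> P * i \<le> k"
      using assms by (simp add: less_eq_div_iff_mult_less_eq mult.commute)
    moreover have "i dvd k - P * i \<longleftrightarrow> i dvd k" if "P * i \<le> k"
      using that by (metis dvd_diff_nat dvd_mult2 dvd_triv_right le_add_diff_inverse dvd_add)
    moreover have "(k - P * i) div i = k div i - P" if "P * i \<le> k"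
      using assms by (metis div_mult_self1 diff_add_inverse2 le_add_diff_inverse2
          less_not_refl that add.commute mult.commute)
    ultimately show ?thesis
      unfolding fps_X_power_mult_nth fps_nth_inverse_one_minus_X_power[OF assms(1)]
      by (cases "P * i \<le> k") auto
  qed
  have B: "fps_nth ?B (y - k) = real ((y + M - e - k) choose M)" if "k \<le> y" for k
  proof (cases "y - k < e")
    case True
    then have "y + M - e - k < M" using that assms by linarith
    then have "(y + M - e - k) choose M = 0" by (rule binomial_eq_0)
    then show ?thesis using True by (simp only: fps_X_power_mult_nth if_True of_nat_0)
  next
    case False
    then have "y - k - e + M = y + M - e - k" using that by linarith
    then show ?thesis using False fps_nth_inverse_one_minus_X_power[of 1 M "y - k - e"]
      by (simp add: fps_X_power_mult_nth)
  qed
  have "kernel P e N M i = ?A * ?B"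
    by (simp only: kernel_def power_add mult_ac)
  then have "fps_nth (kernel P e N M i) y = (\<Sum>k=0..y. fps_nth ?A k * fps_nth ?B (y - k))"
    by (simp only: fps_mult_nth)
  also have "\<dots> = (\<Sum>k=0..y. (if i dvd k \<and> i \<le> k div P
       then real ((k div i - P + N) choose N) * real ((y + M - e - k) choose M) else 0))"
    by (intro sum.cong refl, subst A, subst B) auto
  also have "\<dots> = (\<Sum>k=1..y. (if i dvd k \<and> i \<le> k div P
       then real ((k div i - P + N) choose N) * real ((y + M - e - k) choose M) else 0))"
    using assms by (intro sum.mono_neutral_right) auto
  finally show ?thesis .
qed

section \<open>Polynomial expansion of a shifted binomial\<close>

text \<open>The coefficient of \<open>y ^ u\<close> in \<open>(y - c) gchoose N\<close>, arranged
  like the sum over \<open>j\<close> in \<open>C42\<close>, \<open>C43\<close>, \<open>C82\<close>,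
  \<open>C83\<close> to match termwise. The shift \<open>c\<close> is an integer because
  \<open>P - N\<close> may be negative.\<close>

definition shifted_binomial_coeff :: "nat \<Rightarrow> int \<Rightarrow> nat \<Rightarrow> real" where
  "shifted_binomial_coeff N c u =
    (\<Sum>j=0..N. real (stirling N j) * real (j choose u)
       * ((-1) powi (int N - int u) * of_int c powi (int j - int u) / fact N))"

text \<open>Up to sign and factorial the left side is \<open>pochhammer (c - y) N\<close>, with
  unsigned Stirling numbers as coefficients; the binomial theorem then expands each
  \<open>(c - y) ^ j\<close>. The limit \<open>s\<close> makes the range of \<open>u\<close>
  independent of \<open>r\<close>.\<close>

lemma gbinomial_shift_expansion:
  fixes y :: real
  assumes "N \<le> s"
  shows "(y - of_int c) gchoose N = (\<Sum>u=0..s. shifted_binomial_coeff N c u * y ^ u)"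
proof -
  \<comment> \<open>\<open>u\<close> may exceed \<open>N\<close>, so the exponent can be negative;
    this is harmless because -1 is its own inverse.\<close>
  have sgn: "(-1::real) powi (int N - int u) = (-1) ^ N * (-1) ^ u" for u
    by (simp add: power_int_diff divide_inverse flip: power_inverse)
  have pow: "(of_int c - y) ^ j =
      (\<Sum>u=0..s. real (j choose u) * ((-1) ^ u * of_int c powi (int j - int u) * y ^ u))"
    if "j \<le> N" for j
  proof -
    have "(of_int c - y) ^ j = (\<Sum>u\<le>j. real (j choose u) * (- y) ^ u * of_int c ^ (j - u))"
      using binomial_ring[of "- y" "of_int c" j] by simp
    also have "\<dots> =
        (\<Sum>u\<le>j. real (j choose u) * ((-1) ^ u * of_int c powi (int j - int u) * y ^ u))"
    proof (intro sum.cong refl)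
      fix u assume "u \<in> {..j}"
      then have "int j - int u = int (j - u)" by simp
      then show "real (j choose u) * (- y) ^ u * of_int c ^ (j - u) =
          real (j choose u) * ((-1) ^ u * of_int c powi (int j - int u) * y ^ u)"
        by (simp only: power_int_of_nat power_minus[of y]) (simp add: mult_ac)
    qed
    also have "\<dots> =
        (\<Sum>u=0..s. real (j choose u) * ((-1) ^ u * of_int c powi (int j - int u) * y ^ u))"
      using that assms by (intro sum.mono_neutral_left) auto
    finally show ?thesis .
  qed
  have "(y - of_int c) gchoose N = (-1) ^ N * pochhammer (of_int c - y) N / fact N"
    by (simp add: gbinomial_pochhammer)
  also have "\<dots> = (-1) ^ N * (\<Sum>j=0..N. real (stirling N j) * (of_int c - y) ^ j) / fact N"
    by (simp add: stirling_pochhammer[symmetric] atMost_atLeast0)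
  also have "\<dots> = (\<Sum>j=0..N. \<Sum>u=0..s. (-1) ^ N * (real (stirling N j)
      * (real (j choose u) * ((-1) ^ u * of_int c powi (int j - int u) * y ^ u))) / fact N)"
    by (simp add: pow sum_distrib_left sum_divide_distrib)
  also have "\<dots> = (\<Sum>u=0..s. shifted_binomial_coeff N c u * y ^ u)"
    unfolding shifted_binomial_coeff_def sum_distrib_right
    by (subst sum.swap) (simp add: sgn mult_ac)
  finally show ?thesis .
qed

section \<open>Summation over \<open>i\<close>: from kernels to bounded-divisor sums\<close>

text \<open>The part of a coefficient that does not depend on \<open>i\<close>; it multiplies the
  divisor sum whose exponent is lowered by \<open>u\<close>.\<close>

definition kernel_weight ::
    "nat \<Rightarrow> nat \<Rightarrow> nat \<Rightarrow> nat \<Rightarrow> nat \<Rightarrow> nat \<Rightarrow> nat \<Rightarrow> real" where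
  "kernel_weight P e N M y u k =
    real ((y + M - e - k) choose M) * shifted_binomial_coeff N (int P - int N) u * real k ^ u"

text \<open>The slack \<open>y \<le> L\<close> lets one range \<open>1..x+1\<close> serve both
  \<open>S4\<close>, read at \<open>y = x\<close>, and \<open>S8\<close>, read at
  \<open>y = x + 1\<close>.\<close>

lemma sum_kernel_coeff:
  assumes "P > 0" and "e \<le> M" and "N \<le> s" and "y \<le> L"
  shows "(\<Sum>i=1..L. real i powr \<beta> * fps_nth (kernel P e N M i) y) =
    (\<Sum>u=0..s. \<Sum>k=1..y. kernel_weight P e N M y u k * bdd_divisor_sum (\<beta> - real u) P k)"
proof -
  let ?b = "\<lambda>k. real ((y + M - e - k) choose M)"
  let ?w = "shifted_binomial_coeff N (int P - int N)"
  have expand: "real i powr \<beta> * (real ((k div i - P + N) choose N) * ?b k) =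
      (\<Sum>u=0..s. ?b k * ?w u * real k ^ u * real i powr (\<beta> - real u))"
    if "i > 0" and "i dvd k" and "i \<le> k div P" for i k
  proof -
    from that(2) obtain t where t: "k = i * t" ..
    \<comment> \<open>The divisor bound gives \<open>P \<le> t\<close> for \<open>t = k / i\<close>,
      so \<open>t - P + N\<close> involves no truncation and equals
      \<open>t - (P - N)\<close>.\<close>
    have "P * i \<le> k"
      using that(3) assms(1) by (simp add: less_eq_div_iff_mult_less_eq mult.commute)
    then have "P \<le> t" using t that(1) by (simp add: mult.commute)
    then have "real ((k div i - P + N) choose N) =
        (real t - of_int (int P - int N)) gchoose N"
      using t that(1) by (simp add: binomial_gbinomial of_nat_diff algebra_simps)
    also have "\<dots> = (\<Sum>u=0..s. ?w u * real t ^ u)"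
      by (rule gbinomial_shift_expansion[OF assms(3)])
    finally have "real i powr \<beta> * (real ((k div i - P + N) choose N) * ?b k) =
        (\<Sum>u=0..s. ?b k * ?w u * real t ^ u * real i powr \<beta>)"
      by (simp add: sum_distrib_left sum_distrib_right mult_ac)
    also have "\<dots> = (\<Sum>u=0..s. ?b k * ?w u * real k ^ u * real i powr (\<beta> - real u))"
      using that(1) by (intro sum.cong refl)
        (simp add: t powr_diff powr_realpow power_mult_distrib field_simps)
    finally show ?thesis .
  qed
  \<comment> \<open>A divisor of a positive \<open>k \<le> y\<close> is positive and at most
    \<open>y \<le> L\<close>, so restricting to \<open>{1..L}\<close> loses nothing.\<close>
  have divisors: "{i \<in> {1..L}. i dvd k \<and> i \<le> k div P} = {d. d dvd k \<and> d \<le> k div P}"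
    if "k \<in> {1..y}" for k
    using that assms(4) by (auto dest: dvd_imp_le intro!: Suc_leI Nat.gr0I)
  have "(\<Sum>i=1..L. real i powr \<beta> * fps_nth (kernel P e N M i) y) =
      (\<Sum>i=1..L. \<Sum>k=1..y. if i dvd k \<and> i \<le> k div P
        then \<Sum>u=0..s. ?b k * ?w u * real k ^ u * real i powr (\<beta> - real u) else 0)"
  proof (intro sum.cong refl)
    fix i assume "i \<in> {1..L}"
    then have i: "i > 0" by simp
    show "real i powr \<beta> * fps_nth (kernel P e N M i) y =
        (\<Sum>k=1..y. if i dvd k \<and> i \<le> k div P
          then \<Sum>u=0..s. ?b k * ?w u * real k ^ u * real i powr (\<beta> - real u) else 0)"
      unfolding fps_nth_kernel[OF i assms(1,2)] sum_distrib_left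
      by (intro sum.cong refl) (auto simp only: expand[OF i] mult_zero_right split: if_splits)
  qed
  also have "\<dots> = (\<Sum>k=1..y. \<Sum>i\<in>{1..L}. if i dvd k \<and> i \<le> k div P
        then \<Sum>u=0..s. ?b k * ?w u * real k ^ u * real i powr (\<beta> - real u) else 0)"
    by (rule sum.swap)
  also have "\<dots> = (\<Sum>k=1..y. \<Sum>i | i dvd k \<and> i \<le> k div P.
        \<Sum>u=0..s. ?b k * ?w u * real k ^ u * real i powr (\<beta> - real u))"
    by (rule sum.cong[OF refl]) (simp only: sum.inter_filter[symmetric] finite_atLeastAtMost divisors)
  also have "\<dots> = (\<Sum>k=1..y. \<Sum>u=0..s. ?b k * ?w u * real k ^ u
      * bdd_divisor_sum (\<beta> - real u) P k)"
    unfolding bdd_divisor_sum_def sum_distrib_left by (intro sum.cong refl sum.swap)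
  also have "\<dots> = (\<Sum>u=0..s. \<Sum>k=1..y. ?b k * ?w u * real k ^ u
      * bdd_divisor_sum (\<beta> - real u) P k)"
    by (rule sum.swap)
  finally show ?thesis by (simp add: kernel_weight_def)
qed

section \<open>Reduction of the infinite sums to finite combinations of kernels\<close>

text \<open>Convergence of power series makes each coefficient eventually constant, and terms of
  index beyond \<open>n\<close> do not touch coefficient \<open>n\<close>.\<close>

lemma fps_nth_suminf:
  fixes f :: "nat \<Rightarrow> real fps"
  assumes "\<And>i n. n < i \<Longrightarrow> fps_nth (f i) n = 0"
  shows "fps_nth (suminf f) n = (\<Sum>i\<le>n. fps_nth (f i) n)"
proof -
  have "(\<lambda>N. \<Sum>i<N. f i) \<longlonglongrightarrow> suminf f"
    using fps_summableI[OF assms] by (simp add: summable_LIMSEQ)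
  then have "\<forall>\<^sub>F N in sequentially. fps_nth (\<Sum>i<N. f i) n = fps_nth (suminf f) n"
    by (simp add: tendsto_fps_iff)
  then obtain N where "fps_nth (\<Sum>i<N. f i) n = fps_nth (suminf f) n" and "N > n"
    using eventually_happens'[OF _ eventually_conj[OF _ eventually_gt_at_top[of n]]] by force
  moreover have "(\<Sum>i<N. fps_nth (f i) n) = (\<Sum>i\<le>n. fps_nth (f i) n)"
    using \<open>N > n\<close> assms by (intro sum.mono_neutral_right) auto
  ultimately show ?thesis by (simp add: fps_sum_nth)
qed


lemma fps_nth_kernel_eq_0:
  assumes "y < P * i + e"
  shows "fps_nth (kernel P e N M i) y = 0"
  unfolding kernel_def mult.assoc fps_X_power_mult_nth using assms by simp

text \<open>The denominators have nonzero constant term, hence are units, and quotients become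
  accessible to ring algebra.\<close>

lemma fps_divide_eq_mult_inverse:
  assumes "i > 0"
  shows "A / (1 - fps_X ^ i :: real fps) ^ e = A * inverse ((1 - fps_X ^ i) ^ e)"
    and "A / (1 - fps_X :: real fps) ^ e = A * inverse ((1 - fps_X) ^ e)"
  using fps_nth_one_minus_X_power_0[OF assms] fps_nth_one_minus_X_power_0[of 1]
  by (simp_all add: fps_divide_unit)

lemma fps_nth_Sum4:
  assumes "i > 0"
  shows "fps_nth (Sum4 s i) x =
    (\<Sum>r=0..s. \<Sum>p=0..s. \<Sum>m=0..s.
      (real i ^ (m + 1) * fps_nth (kernel (p + 1) r (s - r) r i) x
        - real (r + 1) * real i ^ m * fps_nth (kernel (p + 1) r (s - r) (r + 1) i) x)
      * C4 s r p m)"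
proof -
  have "fps_X ^ ((p + 1) * i + r) / (1 - fps_X ^ i) ^ (s - r + 1)
       * (fps_const a / (1 - fps_X) ^ (r + 1) - fps_const b / (1 - fps_X) ^ (r + 2))
       * fps_const c =
      fps_const c * (fps_const a * kernel (p + 1) r (s - r) r i
        - fps_const b * kernel (p + 1) r (s - r) (r + 1) i)" for r p a b and c :: real
    unfolding kernel_def fps_divide_eq_mult_inverse[OF assms]
    by (simp only: Suc_eq_plus1 add.assoc one_add_one) (simp only: algebra_simps)
  then show ?thesis
    unfolding Sum4_def fps_sum_nth
    by (simp only: fps_mult_left_const_nth fps_sub_nth) (simp only: mult_ac)
qed

text \<open>Multiplying by \<open>q\<close> removes the truncated subtraction in the exponent, hence \<open>x + 1\<close>.\<close>

lemma fps_nth_Sum8: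
  assumes "i > 0"
  shows "fps_nth (Sum8 s i) x =
    (\<Sum>r=0..s. \<Sum>p=0..s. \<Sum>n=0..r+1. \<Sum>w=0..s.
      (real (r choose n) * fps_nth (kernel (p + 2) n (s - r) r i) (x + 1)
        - real ((r + 1) choose n) * fps_nth (kernel (p + 2) n (s - r) (r + 1) i) (x + 1))
      * real i ^ w * C8 s r p n w)"
proof -
  have shift: "fps_nth (fps_X * F) (x + 1) = fps_nth F x" for F :: "real fps"
    by simp
  have "fps_X * (fps_X ^ ((p + 2) * i + n - 1) / (1 - fps_X ^ i) ^ (s - r + 1)
       * (fps_const a * (1 / (1 - fps_X) ^ (r + 1)) - fps_const b * (1 / (1 - fps_X) ^ (r + 2)))
       * fps_const c * fps_const d) =
      fps_const d * (fps_const c * (fps_const a * kernel (p + 2) n (s - r) r i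
        - fps_const b * kernel (p + 2) n (s - r) (r + 1) i))" for r p n a b c and d :: real
  proof -
    \<comment> \<open>\<open>i > 0\<close> makes the exponent positive, so subtracting 1 is
      exact.\<close>
    have "fps_X ^ ((p + 2) * i + n) = (fps_X * fps_X ^ ((p + 2) * i + n - 1) :: real fps)"
      using assms by (simp flip: power_Suc)
    then show ?thesis
      unfolding kernel_def fps_divide_eq_mult_inverse[OF assms]
      by (simp only: Suc_eq_plus1 add.assoc one_add_one) (simp only: algebra_simps mult_1_left)
  qed
  then have "fps_nth (fps_X ^ ((p + 2) * i + n - 1) / (1 - fps_X ^ i) ^ (s - r + 1)
       * (fps_const a * (1 / (1 - fps_X) ^ (r + 1)) - fps_const b * (1 / (1 - fps_X) ^ (r + 2)))
       * fps_const c * fps_const d) x =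
      (a * fps_nth (kernel (p + 2) n (s - r) r i) (x + 1)
        - b * fps_nth (kernel (p + 2) n (s - r) (r + 1) i) (x + 1)) * c * d"
    for r p n a b c and d :: real
    by (subst shift[symmetric])
      (simp only: fps_mult_left_const_nth fps_sub_nth mult_ac)
  then show ?thesis
    unfolding Sum8_def fps_sum_nth by (simp only:)
qed

text \<open>The term for \<open>Suc i\<close> starts in degree at least \<open>Suc i\<close>, so
  only \<open>i \<le> x\<close> matter; reindexing yields the range \<open>1..x+1\<close>.\<close>

lemma S4_eq_sum:
  "S4 s x \<alpha> = (\<Sum>i=1..x+1. real i powr (\<alpha> - 1) * fps_nth (Sum4 s i) x)"
proof -
  have "fps_nth (Sum4 s (Suc i)) n = 0" if "n < i" for i n
  proof -
    have "n < (p + 1) * Suc i + r" for p r using that by (simp add: algebra_simps)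
    then show ?thesis by (simp add: fps_nth_Sum4 fps_nth_kernel_eq_0)
  qed
  then have "S4 s x \<alpha> = (\<Sum>i\<le>x. real (Suc i) powr (\<alpha> - 1) * fps_nth (Sum4 s (Suc i)) x)"
    unfolding S4_def by (subst fps_nth_suminf) (simp_all add: mult.commute)
  also have "\<dots> = (\<Sum>i=1..x+1. real i powr (\<alpha> - 1) * fps_nth (Sum4 s i) x)"
    by (simp only: atMost_atLeast0 One_nat_def add_Suc_right add_0_right
        sum.atLeast_Suc_atMost_Suc_shift o_def)
  finally show ?thesis .
qed

lemma S8_eq_sum:
  "S8 s x \<alpha> = (\<Sum>i=1..x+1. real i powr (\<alpha> - 1) * fps_nth (Sum8 s i) x)"
proof -
  have "fps_nth (Sum8 s (Suc i)) n = 0" if "n < i" for i n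
  proof -
    have "n + 1 < (p + 2) * Suc i + r" for p r using that by (simp add: algebra_simps)
    then show ?thesis by (simp add: fps_nth_Sum8 fps_nth_kernel_eq_0)
  qed
  then have "S8 s x \<alpha> = (\<Sum>i\<le>x. real (Suc i) powr (\<alpha> - 1) * fps_nth (Sum8 s (Suc i)) x)"
    unfolding S8_def by (subst fps_nth_suminf) (simp_all add: mult.commute)
  also have "\<dots> = (\<Sum>i=1..x+1. real i powr (\<alpha> - 1) * fps_nth (Sum8 s i) x)"
    by (simp only: atMost_atLeast0 One_nat_def add_Suc_right add_0_right
        sum.atLeast_Suc_atMost_Suc_shift o_def)
  finally show ?thesis .
qed

section \<open>The coefficients \<open>C42\<close>, \<open>C43\<close>, \<open>C82\<close>,
  \<open>C83\<close> as sums of kernel weights\<close>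

lemma zbinom_of_nat: "zbinom (int a) (int b) = real (a choose b)"
  by (simp add: zbinom_def binomial_gbinomial)

text \<open>With \<open>P = p + 1\<close> and \<open>N = s - r\<close> the base of the power is
  \<open>P - N\<close>, and \<open>e = M = r\<close> reduces the upper index of the binomial to
  \<open>x - k\<close>, nonnegative by assumption.\<close>

lemma C42_eq_sum_kernel_weight:
  assumes "k \<le> x"
  shows "C42 s (int x) (int k) p m u =
    (\<Sum>r=0..s. kernel_weight (p + 1) r (s - r) r x u k * C4 s r p m)"
  unfolding C42_def
proof (intro sum.cong refl)
  fix r assume "r \<in> {0..s}"
  then have "int s - int r = int (s - r)"
    and "int p + 1 - int s + int r = int (p + 1) - int (s - r)" by auto
  moreover have "zbinom (int x - int k) (int r) = real ((x + r - r - k) choose r)"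
    using assms zbinom_of_nat[of "x - k" r] by (simp add: of_nat_diff)
  ultimately show "(\<Sum>j=0..s-r.
       zbinom (int x - int k) (int r) * real (stirling (s - r) j) * real (j choose u)
       * ((-1) powi (int s - int r - int u)
          * of_int (int p + 1 - int s + int r) powi (int j - int u) * of_int (int k) ^ u
          / fact (s - r))
       * C4 s r p m) = kernel_weight (p + 1) r (s - r) r x u k * C4 s r p m"
    unfolding kernel_weight_def shifted_binomial_coeff_def sum_distrib_left sum_distrib_right
    by (intro sum.cong refl)
      (simp only: of_int_of_nat_eq times_divide_eq_left times_divide_eq_right mult_ac)
qed

lemma C43_eq_sum_kernel_weight:
  assumes "k \<le> x"
  shows "C43 s (int x) (int k) p m u =
    (\<Sum>r=0..s. real (r + 1) * kernel_weight (p + 1) r (s - r) (r + 1) x u k * C4 s r p m)"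
  unfolding C43_def
proof (intro sum.cong refl)
  fix r assume "r \<in> {0..s}"
  then have "int s - int r = int (s - r)"
    and "int p + 1 - int s + int r = int (p + 1) - int (s - r)" by auto
  moreover have "zbinom (int x + 1 - int k) (int r + 1) = real ((x + (r + 1) - r - k) choose (r + 1))"
    using assms zbinom_of_nat[of "x + 1 - k" "r + 1"] by (simp add: of_nat_diff algebra_simps)
  ultimately show "(\<Sum>j=0..s-r.
       zbinom (int x + 1 - int k) (int r + 1) * real (stirling (s - r) j) * real (j choose u)
       * ((-1) powi (int s - int r - int u) * real (r + 1)
          * of_int (int p + 1 - int s + int r) powi (int j - int u) * of_int (int k) ^ u
          / fact (s - r))
       * C4 s r p m) = real (r + 1) * kernel_weight (p + 1) r (s - r) (r + 1) x u k * C4 s r p m"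
    unfolding kernel_weight_def shifted_binomial_coeff_def sum_distrib_left sum_distrib_right
    by (intro sum.cong refl)
      (simp only: of_int_of_nat_eq times_divide_eq_left times_divide_eq_right mult_ac)
qed

lemma C82_eq_sum_kernel_weight:
  assumes "k \<le> x + 1"
  shows "C82 s (int x) (int k) w p u =
    (\<Sum>r=0..s. \<Sum>n=0..r+1.
      real (r choose n) * kernel_weight (p + 2) n (s - r) r (x + 1) u k * C8 s r p n w)"
  unfolding C82_def
proof (intro sum.cong refl)
  fix r n assume "r \<in> {0..s}" "n \<in> {0..r + 1}"
  then have "int s - int r = int (s - r)"
    and "int p + 2 - int s + int r = int (p + 2) - int (s - r)" by auto
  \<comment> \<open>For \<open>n = r + 1\<close> and \<open>k = x + 1\<close> the upper argument is
    -1, where \<open>zbinom\<close> need not agree with the truncated natural binomial; the factor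
    \<open>r choose n\<close> is then zero.\<close>
  moreover have "zbinom (int x + 1 - int n - int k + int r) (int r) * real (r choose n)
      = real ((x + 1 + r - n - k) choose r) * real (r choose n)"
  proof (cases "n \<le> r")
    case True
    then have "int x + 1 - int n - int k + int r = int (x + 1 + r - n - k)"
      using assms by linarith
    then show ?thesis by (simp only: zbinom_of_nat)
  qed simp
  ultimately show "(\<Sum>j=0..s-r.
       zbinom (int x + 1 - int n - int k + int r) (int r) * real (r choose n)
       * real (stirling (s - r) j) * real (j choose u)
       * ((-1) powi (int s - int r - int u)
          * of_int (int p + 2 - int s + int r) powi (int j - int u) * of_int (int k) ^ u
          / fact (s - r))
       * C8 s r p n w) =
      real (r choose n) * kernel_weight (p + 2) n (s - r) r (x + 1) u k * C8 s r p n w"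
    unfolding kernel_weight_def shifted_binomial_coeff_def sum_distrib_left sum_distrib_right
    by (intro sum.cong refl)
      (simp only: of_int_of_nat_eq times_divide_eq_left times_divide_eq_right mult_ac)
qed

lemma C83_eq_sum_kernel_weight:
  assumes "k \<le> x + 1"
  shows "C83 s (int x) (int k) w p u =
    (\<Sum>r=0..s. \<Sum>n=0..r+1.
      real ((r + 1) choose n) * kernel_weight (p + 2) n (s - r) (r + 1) (x + 1) u k * C8 s r p n w)"
  unfolding C83_def
proof (intro sum.cong refl)
  fix r n assume *: "r \<in> {0..s}" "n \<in> {0..r + 1}"
  then have "int s - int r = int (s - r)"
    and "int p + 2 - int s + int r = int (p + 2) - int (s - r)" by auto
  \<comment> \<open>Here \<open>n \<le> r + 1\<close> and \<open>k \<le> x + 1\<close> keep the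
    upper argument nonnegative, so no case split arises.\<close>
  moreover have "zbinom (int x + 2 - int n - int k + int r) (int r + 1)
      = real ((x + 1 + (r + 1) - n - k) choose (r + 1))"
  proof -
    have "int x + 2 - int n - int k + int r = int (x + 1 + (r + 1) - n - k)"
      and "int r + 1 = int (r + 1)"
      using * assms by auto
    then show ?thesis by (simp only: zbinom_of_nat)
  qed
  ultimately show "(\<Sum>j=0..s-r.
       zbinom (int x + 2 - int n - int k + int r) (int r + 1) * real ((r + 1) choose n)
       * real (stirling (s - r) j) * real (j choose u)
       * ((-1) powi (int s - int r - int u)
          * of_int (int p + 2 - int s + int r) powi (int j - int u) * of_int (int k) ^ u
          / fact (s - r))
       * C8 s r p n w) =
      real ((r + 1) choose n) * kernel_weight (p + 2) n (s - r) (r + 1) (x + 1) u k * C8 s r p n w"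
    unfolding kernel_weight_def shifted_binomial_coeff_def sum_distrib_left sum_distrib_right
    by (intro sum.cong refl)
      (simp only: of_int_of_nat_eq times_divide_eq_left times_divide_eq_right mult_ac)
qed

section \<open>Reordering of the sums and assembly\<close>

text \<open>\<open>stirling (s - r) (s + 1)\<close> is zero. This removes the top term when
  \<open>m\<close> is shifted in the theorem.\<close>

lemma C43_out_of_range: "C43 s x k p (s + 1) u = 0"
  by (simp add: C43_def C4_def)

text \<open>Brings \<open>r\<close> innermost, where \<open>C42\<close> and \<open>C43\<close>
  absorb it.\<close>

lemma sum_swap_outermost:
  "(\<Sum>r\<in>R. \<Sum>a\<in>A. \<Sum>b\<in>B. \<Sum>c\<in>C. \<Sum>d\<in>D. f r a b c d) =
   (\<Sum>a\<in>A. \<Sum>b\<in>B. \<Sum>c\<in>C. \<Sum>d\<in>D. \<Sum>r\<in>R. f r a b c d)"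
  by (simp only: sum.swap[where A = R])

text \<open>The range of \<open>n\<close> depends on \<open>r\<close>, so \<open>n\<close> is moved
  inwards before \<open>r\<close>. The exchange of \<open>b\<close> and \<open>c\<close> puts
  \<open>u\<close> before \<open>w\<close>, as in the formula for \<open>S8\<close>.\<close>

lemma sum_swap_outermost_dependent:
  "(\<Sum>r\<in>R. \<Sum>a\<in>A. \<Sum>n\<in>N r. \<Sum>b\<in>B. \<Sum>c\<in>C. \<Sum>d\<in>D. f r a n b c d) =
   (\<Sum>a\<in>A. \<Sum>c\<in>C. \<Sum>b\<in>B. \<Sum>d\<in>D. \<Sum>r\<in>R. \<Sum>n\<in>N r. f r a n b c d)"
  by (simp only: sum.swap[where A = "N r" for r])
    (simp only: sum.swap[where A = R] sum.swap[where A = B and B = C])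

text \<open>The two halves stay apart because the second carries \<open>i ^ m\<close> where the
  first has \<open>i ^ (m + 1)\<close>, so their divisor sums have exponents differing by 1.\<close>

lemma S4_formula:
  "S4 s x \<alpha> =
      (\<Sum>p=0..s. \<Sum>m=0..s. \<Sum>u=0..s. \<Sum>k=1..x.
         C42 s (int x) (int k) p m u * bdd_divisor_sum (real m + \<alpha> - real u) (p + 1) k)
      - (\<Sum>p=0..s. \<Sum>m=0..s. \<Sum>u=0..s. \<Sum>k=1..x.
         C43 s (int x) (int k) p m u * bdd_divisor_sum (real m + \<alpha> - 1 - real u) (p + 1) k)"
proof -
  define T where "T \<beta> p r M = (\<Sum>i=1..x+1. real i powr \<beta> * fps_nth (kernel (p + 1) r (s - r) M i) x)"
    for \<beta> p r M
  have T: "T \<beta> p r M = (\<Sum>u=0..s. \<Sum>k=1..x.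
      kernel_weight (p + 1) r (s - r) M x u k * bdd_divisor_sum (\<beta> - real u) (p + 1) k)"
    if "r \<le> M" for \<beta> p r M
    unfolding T_def using that by (intro sum_kernel_coeff) auto
  have "S4 s x \<alpha> = (\<Sum>i=1..x+1. \<Sum>r=0..s. \<Sum>p=0..s. \<Sum>m=0..s.
      (real i powr (real m + \<alpha>) * fps_nth (kernel (p + 1) r (s - r) r i) x
        - real (r + 1) * (real i powr (real m + \<alpha> - 1) * fps_nth (kernel (p + 1) r (s - r) (r + 1) i) x))
      * C4 s r p m)"
    unfolding S4_eq_sum
  proof (intro sum.cong refl)
    fix i assume "i \<in> {1..x + 1}"
    then have i: "i > 0" by simp
    then have "real i powr (real m + \<alpha>) = real i powr (\<alpha> - 1) * real i ^ (m + 1)"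
      and "real i powr (real m + \<alpha> - 1) = real i powr (\<alpha> - 1) * real i ^ m" for m
      by (simp_all add: powr_add[symmetric] powr_realpow[symmetric] del: power_Suc)
        (simp_all add: algebra_simps)
    then show "real i powr (\<alpha> - 1) * fps_nth (Sum4 s i) x = (\<Sum>r=0..s. \<Sum>p=0..s. \<Sum>m=0..s.
      (real i powr (real m + \<alpha>) * fps_nth (kernel (p + 1) r (s - r) r i) x
        - real (r + 1) * (real i powr (real m + \<alpha> - 1) * fps_nth (kernel (p + 1) r (s - r) (r + 1) i) x))
      * C4 s r p m)"
      unfolding fps_nth_Sum4[OF i] sum_distrib_left
      by (simp only: algebra_simps)
  qed
  also have "\<dots> = (\<Sum>r=0..s. \<Sum>p=0..s. \<Sum>m=0..s.
      (T (real m + \<alpha>) p r r - real (r + 1) * T (real m + \<alpha> - 1) p r (r + 1)) * C4 s r p m)"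
    unfolding T_def sum_distrib_left sum_distrib_right sum_subtractf[symmetric]
    by (simp only: sum.swap[where A = "{1..x+1}"])
  also have "\<dots> = (\<Sum>r=0..s. \<Sum>p=0..s. \<Sum>m=0..s. \<Sum>u=0..s. \<Sum>k=1..x.
        kernel_weight (p + 1) r (s - r) r x u k * C4 s r p m
          * bdd_divisor_sum (real m + \<alpha> - real u) (p + 1) k)
      - (\<Sum>r=0..s. \<Sum>p=0..s. \<Sum>m=0..s. \<Sum>u=0..s. \<Sum>k=1..x.
        real (r + 1) * kernel_weight (p + 1) r (s - r) (r + 1) x u k * C4 s r p m
          * bdd_divisor_sum (real m + \<alpha> - 1 - real u) (p + 1) k)"
    by (simp only: T[OF order_refl] T[OF le_add1] left_diff_distrib sum_distrib_left
        sum_distrib_right sum_subtractf) (simp only: mult_ac)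
  also have "\<dots> = (\<Sum>p=0..s. \<Sum>m=0..s. \<Sum>u=0..s. \<Sum>k=1..x.
         C42 s (int x) (int k) p m u * bdd_divisor_sum (real m + \<alpha> - real u) (p + 1) k)
      - (\<Sum>p=0..s. \<Sum>m=0..s. \<Sum>u=0..s. \<Sum>k=1..x.
         C43 s (int x) (int k) p m u * bdd_divisor_sum (real m + \<alpha> - 1 - real u) (p + 1) k)"
    by (rule arg_cong2[where f = "(-)"]; rule trans[OF sum_swap_outermost]; intro sum.cong refl)
      (simp_all add: C42_eq_sum_kernel_weight C43_eq_sum_kernel_weight sum_distrib_right)
  finally show ?thesis .
qed

text \<open>Both halves carry the same power of \<open>i\<close>, so \<open>C82\<close> and
  \<open>C83\<close> combine under one divisor sum without an index shift.\<close>

lemma S8_formula: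
  "S8 s x \<alpha> =
      (\<Sum>p=0..s. \<Sum>u=0..s. \<Sum>w=0..s. \<Sum>k=1..x+1.
         (C82 s (int x) (int k) w p u - C83 s (int x) (int k) w p u)
         * bdd_divisor_sum (real w + \<alpha> - 1 - real u) (p + 2) k)"
proof -
  define T where "T \<beta> p r n M =
      (\<Sum>i=1..x+1. real i powr \<beta> * fps_nth (kernel (p + 2) n (s - r) M i) (x + 1))" for \<beta> p r n M
  have T: "T \<beta> p r n M = (\<Sum>u=0..s. \<Sum>k=1..x+1.
      kernel_weight (p + 2) n (s - r) M (x + 1) u k * bdd_divisor_sum (\<beta> - real u) (p + 2) k)"
    if "n \<le> M" for \<beta> p r n M
    unfolding T_def using that by (intro sum_kernel_coeff) auto
  have "S8 s x \<alpha> = (\<Sum>i=1..x+1. \<Sum>r=0..s. \<Sum>p=0..s. \<Sum>n=0..r+1. \<Sum>w=0..s.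
      (real (r choose n) * (real i powr (real w + \<alpha> - 1)
          * fps_nth (kernel (p + 2) n (s - r) r i) (x + 1))
        - real ((r + 1) choose n) * (real i powr (real w + \<alpha> - 1)
          * fps_nth (kernel (p + 2) n (s - r) (r + 1) i) (x + 1)))
      * C8 s r p n w)"
    unfolding S8_eq_sum
  proof (intro sum.cong refl)
    fix i assume "i \<in> {1..x + 1}"
    then have i: "i > 0" by simp
    then have "real i powr (real w + \<alpha> - 1) = real i powr (\<alpha> - 1) * real i ^ w" for w
      by (simp add: powr_add[symmetric] powr_realpow[symmetric]) (simp add: algebra_simps)
    then show "real i powr (\<alpha> - 1) * fps_nth (Sum8 s i) x =
      (\<Sum>r=0..s. \<Sum>p=0..s. \<Sum>n=0..r+1. \<Sum>w=0..s.
      (real (r choose n) * (real i powr (real w + \<alpha> - 1)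
          * fps_nth (kernel (p + 2) n (s - r) r i) (x + 1))
        - real ((r + 1) choose n) * (real i powr (real w + \<alpha> - 1)
          * fps_nth (kernel (p + 2) n (s - r) (r + 1) i) (x + 1)))
      * C8 s r p n w)"
      unfolding fps_nth_Sum8[OF i] sum_distrib_left
      by (simp only: algebra_simps)
  qed
  also have "\<dots> = (\<Sum>r=0..s. \<Sum>p=0..s. \<Sum>n=0..r+1. \<Sum>w=0..s.
      (real (r choose n) * T (real w + \<alpha> - 1) p r n r
        - real ((r + 1) choose n) * T (real w + \<alpha> - 1) p r n (r + 1)) * C8 s r p n w)"
    unfolding T_def sum_distrib_left sum_distrib_right sum_subtractf[symmetric]
    by (simp only: sum.swap[where A = "{1..x+1}"])
  also have "\<dots> = (\<Sum>r=0..s. \<Sum>p=0..s. \<Sum>n=0..r+1. \<Sum>w=0..s. \<Sum>u=0..s. \<Sum>k=1..x+1.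
      (real (r choose n) * kernel_weight (p + 2) n (s - r) r (x + 1) u k * C8 s r p n w
        - real ((r + 1) choose n) * kernel_weight (p + 2) n (s - r) (r + 1) (x + 1) u k
          * C8 s r p n w)
      * bdd_divisor_sum (real w + \<alpha> - 1 - real u) (p + 2) k)"
  proof (intro sum.cong refl)
    fix r p n w :: nat assume n: "n \<in> {0..r+1}"
    have "real (r choose n) * T (real w + \<alpha> - 1) p r n r =
      real (r choose n) * (\<Sum>u=0..s. \<Sum>k=1..x+1. kernel_weight (p + 2) n (s - r) r (x + 1) u k
        * bdd_divisor_sum (real w + \<alpha> - 1 - real u) (p + 2) k)"
      \<comment> \<open>For \<open>n = r + 1\<close> the formula for \<open>T\<close> may fail, but \<open>r choose n\<close> vanishes.\<close>
    proof (cases "n \<le> r")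
      case True
      then show ?thesis by (simp only: T)
    qed simp
    moreover have "n \<le> r + 1" using n by simp
    ultimately show "(real (r choose n) * T (real w + \<alpha> - 1) p r n r
        - real ((r + 1) choose n) * T (real w + \<alpha> - 1) p r n (r + 1)) * C8 s r p n w =
      (\<Sum>u=0..s. \<Sum>k=1..x+1.
      (real (r choose n) * kernel_weight (p + 2) n (s - r) r (x + 1) u k * C8 s r p n w
        - real ((r + 1) choose n) * kernel_weight (p + 2) n (s - r) (r + 1) (x + 1) u k
          * C8 s r p n w)
      * bdd_divisor_sum (real w + \<alpha> - 1 - real u) (p + 2) k)"
      by (simp only: T sum_distrib_left sum_distrib_right sum_subtractf[symmetric])
        (simp only: algebra_simps)
  qed
  also have "\<dots> = (\<Sum>p=0..s. \<Sum>u=0..s. \<Sum>w=0..s. \<Sum>k=1..x+1.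
         (C82 s (int x) (int k) w p u - C83 s (int x) (int k) w p u)
         * bdd_divisor_sum (real w + \<alpha> - 1 - real u) (p + 2) k)"
    unfolding sum_swap_outermost_dependent[where R = "{0..s}"]
    by (intro sum.cong refl)
      (simp only: C82_eq_sum_kernel_weight C83_eq_sum_kernel_weight atLeastAtMost_iff
        sum_distrib_right sum_subtractf[symmetric])
  finally show ?thesis .
qed

theorem mainTheorem3:
  fixes \<alpha> :: real and s x :: nat
  assumes "\<alpha> \<ge> 0" and "s \<ge> 1" and "x \<ge> 1"
  shows "S4 s x \<alpha> =
      (\<Sum>p=0..s. \<Sum>m=0..s. \<Sum>u=0..s. \<Sum>k=1..x.
         (C42 s (int x) (int k) p m u - C43 s (int x) (int k) p (m + 1) u)
         * bdd_divisor_sum (real m + \<alpha> - real u) (p + 1) k)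
      - (\<Sum>p=0..s. \<Sum>u=0..s. \<Sum>k=1..x.
           C43 s (int x) (int k) p 0 u * bdd_divisor_sum (\<alpha> - 1 - real u) (p + 1) k)
    \<and> S8 s x \<alpha> =
      (\<Sum>p=0..s. \<Sum>u=0..s. \<Sum>w=0..s. \<Sum>k=1..x+1.
         (C82 s (int x) (int k) w p u - C83 s (int x) (int k) w p u)
         * bdd_divisor_sum (real w + \<alpha> - 1 - real u) (p + 2) k)"
proof
  \<comment> \<open>Shifting \<open>m\<close> by one in the \<open>C43\<close> sum turns the
    exponent \<open>m + \<alpha> - 1 - u\<close> into \<open>m + \<alpha> - u\<close>, matching the
    \<open>C42\<close> sum; the term \<open>m = 0\<close> becomes the separate sum.\<close>
  have "(\<Sum>m=0..s. f m) = f 0 + (\<Sum>m=0..s. f (m + 1))" if "f (s + 1) = 0" for f :: "nat \<Rightarrow> real"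
    using that sum.atLeast0_atMost_Suc_shift[of f s] by simp
  note shift = this[of "\<lambda>m. \<Sum>u=0..s. \<Sum>k=1..x.
      C43 s (int x) (int k) p m u * bdd_divisor_sum (real m + \<alpha> - 1 - real u) (p + 1) k" for p]
  show "S4 s x \<alpha> =
      (\<Sum>p=0..s. \<Sum>m=0..s. \<Sum>u=0..s. \<Sum>k=1..x.
         (C42 s (int x) (int k) p m u - C43 s (int x) (int k) p (m + 1) u)
         * bdd_divisor_sum (real m + \<alpha> - real u) (p + 1) k)
      - (\<Sum>p=0..s. \<Sum>u=0..s. \<Sum>k=1..x.
           C43 s (int x) (int k) p 0 u * bdd_divisor_sum (\<alpha> - 1 - real u) (p + 1) k)"
    unfolding S4_formula
    by (subst shift)
      (simp_all only: C43_out_of_range left_diff_distrib sum_subtractf sum.distrib,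
        simp_all add: algebra_simps)
qed (rule S8_formula)

end
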